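(* For every integer $k \geq 4$ there exist a constant $c_k$, a $k$-uniform hypergraph $\mathcal{H}$ and a sequence $(\mathcal{G}_n)$ of $\mathcal{H}$-free $k$-uniform hypergraphs, $\mathcal{G}_n$ having $n$ vertices, such that the size of the largest clique or independent set in $\mathcal{G}_n$ is at most $c_k\, r_k^{-1}(n)$.
   Context: A $k$-uniform hypergraph $\mathcal{G}$ is $\mathcal{H}$-free if it contains no induced copy of $\mathcal{H}$, i.e. there is no injection of $V(\mathcal{H})$ into $V(\mathcal{G})$ under which a $k$-set of $V(\mathcal{H})$ is an edge of $\mathcal{H}$ if and only if its image is an edge of $\mathcal{G}$. A clique (resp. independent set) in $\mathcal{G}$ is a vertex set all of whose $k$-subsets are edges (resp. none of whose $k$-subsets are edges). The diagonal Ramsey number $r_k(\ell)$ is the minimum $n$ such that in every red/blue colouring of the $k$-subsets of an $n$-element set there is an $\ell$-element set all of whose $k$-subsets have the same colour; $r_k^{-1}$ denotes the inverse function of $r_k$, i.e. $r_k^{-1}(n)$ is the largest $\ell$ with $r_k(\ell) \le n$. *)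

theory Defs
  imports Complex_Main "HOL-Library.Ramsey"
begin

datatype 'a hypergraph = Hypergraph (verts: "'a set") (edges: "'a set set")

definition uniform_hypergraph :: "nat \<Rightarrow> 'a hypergraph \<Rightarrow> bool" where
  "uniform_hypergraph k G \<longleftrightarrow> finite (verts G) \<and> edges G \<subseteq> [verts G]\<^bsup>k\<^esup>"

definition induced_copy :: "nat \<Rightarrow> ('a \<Rightarrow> 'b) \<Rightarrow> 'a hypergraph \<Rightarrow> 'b hypergraph \<Rightarrow> bool" where
  "induced_copy k f H G \<longleftrightarrow>
     f ` verts H \<subseteq> verts G \<and> inj_on f (verts H) \<and>
     (\<forall>e \<in> [verts H]\<^bsup>k\<^esup>. e \<in> edges H \<longleftrightarrow> f ` e \<in> edges G)"

definition hypergraph_free :: "nat \<Rightarrow> 'a hypergraph \<Rightarrow> 'b hypergraph \<Rightarrow> bool" where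
  "hypergraph_free k H G \<longleftrightarrow> (\<nexists>f. induced_copy k f H G)"

definition clique_in :: "nat \<Rightarrow> 'a hypergraph \<Rightarrow> 'a set \<Rightarrow> bool" where
  "clique_in k G S \<longleftrightarrow> S \<subseteq> verts G \<and> [S]\<^bsup>k\<^esup> \<subseteq> edges G"

definition independent_in :: "nat \<Rightarrow> 'a hypergraph \<Rightarrow> 'a set \<Rightarrow> bool" where
  "independent_in k G S \<longleftrightarrow> S \<subseteq> verts G \<and> [S]\<^bsup>k\<^esup> \<inter> edges G = {}"

text \<open>Sets with fewer than \<open>k\<close> vertices are both cliques and independent sets, so the
  maximum below is taken over a nonempty set; it is finite whenever the vertex set is.\<close>

definition homogeneous_number :: "nat \<Rightarrow> 'a hypergraph \<Rightarrow> nat" where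
  "homogeneous_number k G = Max {card S | S. clique_in k G S \<or> independent_in k G S}"

text \<open>The two colours are the two elements of type \<^typ>\<open>bool\<close>. For \<open>l < k\<close> every
  \<open>l\<close>-set is vacuously monochromatic, so that the Ramsey number is then \<open>l\<close>.\<close>

definition ramsey_number :: "nat \<Rightarrow> nat \<Rightarrow> nat" where
  "ramsey_number k l = (LEAST n. partn {..<n} l k (UNIV :: bool set))"

definition ramsey_inverse :: "nat \<Rightarrow> nat \<Rightarrow> nat" where
  "ramsey_inverse k n = (GREATEST l. ramsey_number k l \<le> n)"

text \<open>The minima and maxima above are attained.\<close>

lemma partn_ramsey_number: "partn {..<ramsey_number k l} l k (UNIV :: bool set)"
proof -
  have "partn {..<ES k l l} l k (UNIV :: bool set)"
    unfolding partn_def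
  proof
    fix f :: "nat set \<Rightarrow> bool"
    define g :: "nat set \<Rightarrow> nat" where "g = of_bool \<circ> f"
    have "g \<in> [{..<ES k l l}]\<^bsup>k\<^esup> \<rightarrow> {..<2}" by (auto simp: g_def)
    with ramsey2_full[of k l l] obtain i H where i: "i < 2"
      and H: "H \<in> [{..<ES k l l}]\<^bsup>([l,l] ! i)\<^esup>" "g ` [H]\<^bsup>k\<^esup> \<subseteq> {i}"
      by (elim partn_lstE) (auto simp: numeral_2_eq_2)
    from i have "[l,l] ! i = l" by (auto simp: less_2_cases_iff)
    moreover have "f ` [H]\<^bsup>k\<^esup> \<subseteq> {i = 1}"
      using H(2) by (auto simp: g_def of_bool_def split: if_splits)
    ultimately show "\<exists>\<xi>\<in>UNIV. monochromatic {..<ES k l l} l k f \<xi>"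
      using H(1) unfolding monochromatic_def by auto
  qed
  then show ?thesis unfolding ramsey_number_def by (rule LeastI)
qed

lemma le_ramsey_number: "l \<le> ramsey_number k l"
proof -
  obtain H where "H \<in> [{..<ramsey_number k l}]\<^bsup>l\<^esup>"
    using partn_ramsey_number[of k l] unfolding partn_def monochromatic_def by blast
  then have "H \<subseteq> {..<ramsey_number k l}" "card H = l" by (auto simp: nsets_def)
  then show ?thesis using card_mono[of "{..<ramsey_number k l}" H] by simp
qed

lemma ramsey_number_0: "ramsey_number k 0 = 0"
proof -
  have "monochromatic {..<0::nat} 0 k f (f {})" for f :: "nat set \<Rightarrow> bool"
    by (auto simp: monochromatic_def nsets_empty_iff)
  then have "partn {..<0::nat} 0 k (UNIV :: bool set)" unfolding partn_def by blast
  then show ?thesis unfolding ramsey_number_def by (simp add: Least_eq_0)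
qed

lemma ramsey_number_inverse: "ramsey_number k (ramsey_inverse k n) \<le> n"
  unfolding ramsey_inverse_def
  by (rule GreatestI_nat[where k = 0 and b = n])
    (auto simp: ramsey_number_0 intro: order_trans[OF le_ramsey_number])

lemma le_ramsey_inverse: "ramsey_number k l \<le> n \<Longrightarrow> l \<le> ramsey_inverse k n"
  unfolding ramsey_inverse_def
  by (rule Greatest_le_nat[where b = n]) (auto intro: order_trans[OF le_ramsey_number])

lemma homogeneous_number_le_iff:
  assumes "uniform_hypergraph k G" "k > 0"
  shows "homogeneous_number k G \<le> m \<longleftrightarrow>
    (\<forall>S. clique_in k G S \<or> independent_in k G S \<longrightarrow> card S \<le> m)"
proof -
  let ?A = "{S. clique_in k G S \<or> independent_in k G S}"
  have "?A \<subseteq> Pow (verts G)" by (auto simp: clique_in_def independent_in_def)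
  then have "finite (card ` ?A)"
    using assms by (meson finite_Pow_iff finite_imageI finite_subset uniform_hypergraph_def)
  moreover have "{} \<in> ?A" using assms by (auto simp: clique_in_def nsets_empty_iff)
  ultimately show ?thesis
    unfolding homogeneous_number_def setcompr_eq_image by (subst Max_le_iff) auto
qed

end

theory Submission
  imports Defs
begin

text \<open>
  Take an optimal colouring of the \<open>k\<close>-subsets of \<open>n\<close> points and put \<open>q = k - 1\<close>. The Erdos--Rado
  argument yields a colouring of the \<open>q\<close>-subsets of \<open>M\<close> points without larger homogeneous sets,
  where \<open>M\<close> is about the \<open>k\<close>-th root of \<open>log n\<close>. Since \<open>q \<ge> 3\<close>, a lexicographic product colouring
  squares the number of points while multiplying the size of homogeneous sets only by \<open>q\<close>, so
  constantly many squarings give at least \<open>log n\<close> points with homogeneous sets only a constant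
  factor larger. Stepping up returns to \<open>k\<close>-subsets of \<open>n\<close> points at the cost of another constant
  factor.

  The step-up colour of a set depends only on its order and on the levels at which the binary
  expansions of its elements branch. Hence, in any set of vertices, two elements that branch at the
  lowest level are twins: exchanging one for the other does not change the colour. So a hypergraph
  without twins, such as the one whose edges are the complements of the edges of a path on
  \<open>k + 2\<close> vertices, has no induced copy in a step-up colouring.
\<close>

section \<open>Homogeneous sets\<close>

text \<open>The strict bound matches the failure of \<open>partn\<close> at \<open>L\<close>. Sets
  with fewer than \<open>q\<close> points are vacuously homogeneous, in both colours.\<close>

definition homogeneous_below :: "('a set \<Rightarrow> bool) \<Rightarrow> nat \<Rightarrow> 'a set \<Rightarrow> nat \<Rightarrow> bool" where
  "homogeneous_below f q V L \<longleftrightarrow>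
     (\<forall>S \<xi>. S \<subseteq> V \<longrightarrow> (\<forall>e\<in>[S]\<^bsup>q\<^esup>. f e = \<xi>) \<longrightarrow> card S < L)"

lemma homogeneous_belowD:
  "homogeneous_below f q V L \<Longrightarrow> S \<subseteq> V \<Longrightarrow> (\<And>e. e \<in> [S]\<^bsup>q\<^esup> \<Longrightarrow> f e = \<xi>) \<Longrightarrow> card S < L"
  by (simp add: homogeneous_below_def)

text \<open>A homogeneous set with more than \<open>L\<close> points contains one with exactly
  \<open>L\<close> points.\<close>

lemma homogeneous_below_if_not_partn:
  assumes "\<not> partn V L q (UNIV :: bool set)"
  obtains f :: "'a set \<Rightarrow> bool" where "homogeneous_below f q V L"
proof -
  obtain f :: "'a set \<Rightarrow> bool" where f: "\<And>\<xi>. \<not> monochromatic V L q f \<xi>"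
    using assms unfolding partn_def by blast
  have "homogeneous_below f q V L"
    unfolding homogeneous_below_def
  proof (intro allI impI, rule ccontr)
    fix S \<xi>
    assume S: "S \<subseteq> V" "\<forall>e\<in>[S]\<^bsup>q\<^esup>. f e = \<xi>" "\<not> card S < L"
    from S(3) have "L \<le> card S" by simp
    then obtain U where U: "U \<subseteq> S" "card U = L" "finite U"
      by (rule obtain_subset_with_card_n)
    then have "f ` [U]\<^bsup>q\<^esup> \<subseteq> {\<xi>}"
      using S(2) nsets_mono[OF U(1)] by blast
    moreover have "U \<in> [V]\<^bsup>L\<^esup>"
      using U S(1) by (auto simp: nsets_def)
    ultimately show False
      using f unfolding monochromatic_def by blast
  qed
  then show ?thesis by (rule that)
qed

lemma homogeneous_below_image:
  assumes "bij_betw g V W" "homogeneous_below f q W L"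
  shows "homogeneous_below (\<lambda>e. f (g ` e)) q V L"
  unfolding homogeneous_below_def
proof (intro allI impI)
  fix S \<xi>
  assume S: "S \<subseteq> V" "\<forall>e\<in>[S]\<^bsup>q\<^esup>. f (g ` e) = \<xi>"
  have inj: "inj_on g S"
    using assms(1) S(1) by (meson bij_betw_def inj_on_subset)
  have "card (g ` S) < L"
  proof (rule homogeneous_belowD[OF assms(2)])
    show "g ` S \<subseteq> W" using assms(1) S(1) by (auto simp: bij_betw_def)
    fix e assume "e \<in> [g ` S]\<^bsup>q\<^esup>"
    then have e: "e \<subseteq> g ` S" "finite e" "card e = q" by (auto simp: nsets_def)
    then obtain d where d: "d \<subseteq> S" "e = g ` d" by (meson subset_imageE)
    have "inj_on g d" using inj d(1) by (rule inj_on_subset)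
    then have "d \<in> [S]\<^bsup>q\<^esup>"
      using e d by (auto simp: nsets_def card_image finite_image_iff)
    then show "f e = \<xi>" using S(2) d(2) by blast
  qed
  then show "card S < L" by (simp add: card_image inj)
qed

text \<open>Every (q+1)-subset \<open>e\<close> of an \<open>h\<close>-homogeneous set has the
  \<open>f\<close>-colour that \<open>h\<close> gives to \<open>e\<close> without its maximum. So
  the set is \<open>f\<close>-homogeneous too.\<close>

lemma homogeneous_below_end_homogeneous:
  fixes f :: "nat set \<Rightarrow> bool"
  assumes "homogeneous_below f (Suc q) V L" "W \<subseteq> V"
    and last: "\<And>S y. S \<in> [W]\<^bsup>q\<^esup> \<Longrightarrow> y \<in> W \<Longrightarrow> \<forall>s\<in>S. s < y \<Longrightarrow> f (insert y S) = h S"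
  shows "homogeneous_below h q W L"
  unfolding homogeneous_below_def
proof (intro allI impI)
  fix S \<xi>
  assume S: "S \<subseteq> W" "\<forall>e\<in>[S]\<^bsup>q\<^esup>. h e = \<xi>"
  show "card S < L"
  proof (rule homogeneous_belowD[OF assms(1)])
    show "S \<subseteq> V" using S(1) assms(2) by blast
    fix e assume "e \<in> [S]\<^bsup>Suc q\<^esup>"
    then have e: "e \<subseteq> S" "finite e" "card e = Suc q" by (auto simp: nsets_def)
    then have "e \<noteq> {}" by auto
    define y where "y = Max e"
    have y: "y \<in> e" "\<And>x. x \<in> e \<Longrightarrow> x \<le> y"
      using e \<open>e \<noteq> {}\<close> by (auto simp: y_def)
    have E: "e - {y} \<in> [S]\<^bsup>q\<^esup>"
      using e y(1) by (auto simp: nsets_def)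
    have "f (insert y (e - {y})) = h (e - {y})"
    proof (rule last)
      show "e - {y} \<in> [W]\<^bsup>q\<^esup>" using E nsets_mono[OF S(1)] by blast
      show "y \<in> W" using y(1) e(1) S(1) by blast
      show "\<forall>s\<in>e - {y}. s < y" using y(2) by (auto simp: order_less_le)
    qed
    then show "f e = \<xi>"
      using S(2) E y(1) by (simp add: insert_absorb)
  qed
qed

section \<open>Stepping down\<close>

text \<open>The colour of a (q+1)-set with its first \<open>q\<close> points in \<open>W\<close> is
  independent of its last point. That last point may also come from the reservoir \<open>A\<close>,
  which is what lets \<open>W\<close> grow.\<close>

definition end_homogeneous :: "(nat set \<Rightarrow> bool) \<Rightarrow> nat \<Rightarrow> nat set \<Rightarrow> nat set \<Rightarrow> bool" where
  "end_homogeneous f q W A \<longleftrightarrow>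
    (\<forall>S\<in>[W]\<^bsup>q\<^esup>. \<forall>y\<in>W \<union> A. \<forall>z\<in>W \<union> A. (\<forall>s\<in>S. s < y \<and> s < z) \<longrightarrow>
      f (insert y S) = f (insert z S))"

lemma end_homogeneousD:
  "end_homogeneous f q W A \<Longrightarrow> S \<in> [W]\<^bsup>q\<^esup> \<Longrightarrow> y \<in> W \<union> A \<Longrightarrow> z \<in> W \<union> A \<Longrightarrow>
    \<forall>s\<in>S. s < y \<and> s < z \<Longrightarrow> f (insert y S) = f (insert z S)"
  unfolding end_homogeneous_def by (drule (1) bspec)+ (erule mp)

text \<open>The Erdos--Rado selection: \<open>W\<close> is built by repeatedly taking the least element of the
  reservoir \<open>A\<close> and shrinking \<open>A\<close> so that it does not distinguish any \<open>q\<close>-subset of \<open>W\<close>.\<close>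

lemma end_homogeneous_selection:
  fixes f :: "nat set \<Rightarrow> bool"
  assumes "q > 0" "finite V" "i \<le> M" "2 ^ (X + i * (M ^ q + 1)) \<le> card V"
  shows "\<exists>W A. W \<subseteq> V \<and> A \<subseteq> V \<and> card W = i \<and> 2 ^ X \<le> card A \<and> (\<forall>w\<in>W. \<forall>a\<in>A. w < a) \<and>
    end_homogeneous f q W A"
  using assms(3,4)
proof (induction i arbitrary: X)
  case 0
  have "[{}::nat set]\<^bsup>q\<^esup> = {}"
    using assms(1) by (simp add: nsets_empty_iff)
  then show ?case using 0 by (intro exI[of _ "{}"] exI[of _ V]) (auto simp: end_homogeneous_def)
next
  case (Suc i)
  \<comment> \<open>One selection step costs a factor 2 for the removal of the least element and a
    factor \<open>2 ^ (M ^ q)\<close> for the choice of a colour pattern.\<close>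
  have "X + M ^ q + 1 + i * (M ^ q + 1) = X + Suc i * (M ^ q + 1)" by simp
  then have "2 ^ (X + M ^ q + 1 + i * (M ^ q + 1)) \<le> card V" using Suc.prems(2) by (simp only:)
  from Suc.IH[OF _ this] Suc.prems(1) obtain W A where
    W: "W \<subseteq> V" "A \<subseteq> V" "card W = i" "2 ^ (X + M ^ q + 1) \<le> card A" and
    less: "\<And>w a. w \<in> W \<Longrightarrow> a \<in> A \<Longrightarrow> w < a" and
    eq: "end_homogeneous f q W A"
    by auto
  have fin: "finite W" "finite A" using W assms(2) finite_subset by auto
  have "A \<noteq> {}" using W(4) by auto
  define v where "v = Min A"
  have v: "v \<in> A" "\<And>a. a \<in> A \<Longrightarrow> v \<le> a"
    using fin \<open>A \<noteq> {}\<close> by (auto simp: v_def)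
  define W' where "W' = insert v W"
  have "v \<notin> W" using less v(1) by blast
  then have card': "card W' = Suc i" "finite W'" using W(3) fin by (auto simp: W'_def)
  \<comment> \<open>The pattern of \<open>a\<close>: which \<open>q\<close>-subsets of the enlarged
    set receive colour \<open>True\<close> when \<open>a\<close> is added. The pigeonhole principle
    keeps a most popular pattern \<open>D\<close>.\<close>
  define g where "g a = {S \<in> [W']\<^bsup>q\<^esup>. f (insert a S)}" for a
  have finP: "finite (Pow ([W']\<^bsup>q\<^esup>))" using card' by (simp add: finite_imp_finite_nsets)
  have "g \<in> (A - {v}) \<rightarrow> Pow ([W']\<^bsup>q\<^esup>)" by (auto simp: g_def)
  from pigeonhole_card[OF this] fin finP obtain D where
    D: "card (A - {v}) \<le> card (g -` {D} \<inter> (A - {v})) * card (Pow ([W']\<^bsup>q\<^esup>))"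
    by auto
  define A' where "A' = g -` {D} \<inter> (A - {v})"
  have "card ([W']\<^bsup>q\<^esup>) \<le> M ^ q"
  proof -
    have "Suc i choose q \<le> Suc i ^ q"
      by (cases "q \<le> Suc i") (auto simp: binomial_le_pow binomial_eq_0)
    also have "\<dots> \<le> M ^ q" using Suc.prems(1) by (intro power_mono) auto
    finally show ?thesis by (simp add: card')
  qed
  then have cardP: "card (Pow ([W']\<^bsup>q\<^esup>)) \<le> 2 ^ (M ^ q)"
    using card' by (simp add: card_Pow finite_imp_finite_nsets del: card_nsets)
  have "2 ^ (X + M ^ q) + 1 \<le> (2 :: nat) ^ (X + M ^ q + 1)" by simp
  then have "2 ^ (X + M ^ q) \<le> card (A - {v})" using W(4) v(1) fin by simp
  also have "\<dots> \<le> card A' * 2 ^ (M ^ q)"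
    using D cardP unfolding A'_def[symmetric] by (meson mult_le_mono2 order_trans)
  finally have "2 ^ X \<le> card A'" by (simp add: power_add)
  moreover have "end_homogeneous f q W' A'"
    unfolding end_homogeneous_def
  proof (intro ballI impI)
    fix S y z
    assume S: "S \<in> [W']\<^bsup>q\<^esup>" and y: "y \<in> W' \<union> A'" and z: "z \<in> W' \<union> A'"
      and yz: "\<forall>s\<in>S. s < y \<and> s < z"
    show "f (insert y S) = f (insert z S)"
    \<comment> \<open>If \<open>v\<close> is in \<open>S\<close>, then \<open>y\<close> and
      \<open>z\<close> exceed \<open>v\<close>, lie in the new reservoir and share their pattern.
      Otherwise \<open>S\<close> lies in the old \<open>W\<close>, and the old invariant applies
      since \<open>v\<close> came from \<open>A\<close>.\<close>
    proof (cases "v \<in> S")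
      case True
      have *: "x \<in> A'" if "x \<in> W' \<union> A'" "v < x" for x
        using that(1)
      proof
        assume "x \<in> W'"
        then have "x = v \<or> x < v" using less[OF _ v(1)] unfolding W'_def by blast
        then show ?thesis using that(2) by auto
      qed
      have "y \<in> A'" "z \<in> A'" using True y z yz * by auto
      then have "g y = g z" by (auto simp: A'_def)
      then show ?thesis using S unfolding g_def by blast
    next
      case False
      then have "S \<in> [W]\<^bsup>q\<^esup>" using S by (auto simp: nsets_def W'_def)
      moreover have "y \<in> W \<union> A" "z \<in> W \<union> A" using y z v(1) by (auto simp: W'_def A'_def)
      ultimately show ?thesis using end_homogeneousD[OF eq] yz by blast
    qed
  qed
  moreover have "W' \<subseteq> V" "A' \<subseteq> V" using W v(1) by (auto simp: W'_def A'_def)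
  moreover have "\<forall>w\<in>W'. \<forall>a\<in>A'. w < a"
    using less v(2) by (auto simp: W'_def A'_def order_less_le)
  ultimately show ?case using card'(1) by (intro exI[of _ W'] exI[of _ A']) auto
qed

text \<open>The selection with \<open>X = 0\<close> leaves at least one reservoir point
  \<open>a\<close> above an end-homogeneous \<open>W\<close> of size \<open>M\<close>. Adding
  \<open>a\<close> as the last point defines the colouring of \<open>q\<close>-subsets of
  \<open>W\<close>, which is then relabelled to \<open>{..<M}\<close>.\<close>

lemma homogeneous_below_step_down:
  fixes f :: "nat set \<Rightarrow> bool"
  assumes f: "homogeneous_below f (Suc q) {..<n} L" and "q > 0" "2 ^ (M * (M ^ q + 1)) \<le> n"
  obtains h :: "nat set \<Rightarrow> bool" where "homogeneous_below h q {..<M} L"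
proof -
  obtain W A where W: "W \<subseteq> {..<n}" "card W = M" "2 ^ 0 \<le> card A" and
    less: "\<And>w a. w \<in> W \<Longrightarrow> a \<in> A \<Longrightarrow> w < a" and
    eq: "end_homogeneous f q W A"
    using end_homogeneous_selection[of q "{..<n}" M M 0 f] assms(2,3) by auto
  have "A \<noteq> {}" using W(3) by auto
  then obtain a where a: "a \<in> A" by blast
  have "homogeneous_below (\<lambda>S. f (insert a S)) q W L"
  proof (rule homogeneous_below_end_homogeneous[OF f W(1)])
    fix S y assume S: "S \<in> [W]\<^bsup>q\<^esup>" "y \<in> W" "\<forall>s\<in>S. s < y"
    have "\<forall>s\<in>S. s < a" using S(1) less a by (auto simp: nsets_def)
    then show "f (insert y S) = f (insert a S)"
      using S a by (intro end_homogeneousD[OF eq]) auto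
  qed
  moreover have "finite W" using W(1) finite_subset by blast
  then obtain g where "bij_betw g {..<M} W"
    using ex_bij_betw_nat_finite W(2) by (metis atLeast0LessThan)
  ultimately show ?thesis using homogeneous_below_image that by blast
qed

section \<open>Product colourings\<close>

text \<open>The third clause ensures that at most one fibre of \<open>x \<mapsto> x div M\<close> meets a homogeneous set in
  \<open>q - 1\<close> or more points: for two such fibres, \<open>q - 1\<close> points from the lower and one from the upper
  fibre get a different colour than one point from the lower and \<open>q - 1\<close> from the upper.\<close>

definition product_colouring :: "nat \<Rightarrow> (nat set \<Rightarrow> bool) \<Rightarrow> nat set \<Rightarrow> bool" where
  "product_colouring M f e =
    (let p = (\<lambda>x. x div M) in
     if inj_on p e then f (p ` e)
     else if card (p ` e) = 1 then f ((\<lambda>x. x mod M) ` e)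
     else card {x \<in> e. p x = Min (p ` e)} \<ge> 2)"

text \<open>The projection of a homogeneous set and each of its fibres are homogeneous for
  \<open>f\<close>, hence have fewer than \<open>L\<close> points. All fibres but one have at most
  \<open>q - 2\<close> points, so the total is at most \<open>L * (q - 2) + L\<close>, which is less
  than \<open>q * L\<close>.\<close>

lemma homogeneous_below_product:
  assumes f: "homogeneous_below f q {..<M} L" and "q \<ge> 3"
  shows "homogeneous_below (product_colouring M f) q {..<M * M} (q * L)"
  unfolding homogeneous_below_def
proof (intro allI impI)
  fix S \<xi>
  assume S: "S \<subseteq> {..<M * M}" and hom: "\<forall>e\<in>[S]\<^bsup>q\<^esup>. product_colouring M f e = \<xi>"
  define p where "p = (\<lambda>x::nat. x div M)"
  define F where "F a = {x \<in> S. p x = a}" for a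
  have fin: "finite S" using S finite_subset by blast
  then have finF: "finite (F a)" for a by (simp add: F_def)
  have "L > 0" using homogeneous_belowD[OF f, of "{}"] \<open>q \<ge> 3\<close> by (auto simp: nsets_empty_iff)
  have col: "product_colouring M f e = (if inj_on p e then f (p ` e)
      else if card (p ` e) = 1 then f ((\<lambda>x. x mod M) ` e)
      else card {x \<in> e. p x = Min (p ` e)} \<ge> 2)" for e
    by (simp add: product_colouring_def p_def Let_def)
  have M: "M > 0" if "x \<in> S" for x using S that by (cases M) auto
  have proj: "card (p ` S) < L"
  proof (rule homogeneous_belowD[OF f])
    show "p ` S \<subseteq> {..<M}"
      using S by (auto simp: p_def less_mult_imp_div_less)
    fix e assume e: "e \<in> [p ` S]\<^bsup>q\<^esup>"
    then have "e \<subseteq> p ` S" by (simp add: nsets_def)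
    then obtain d where d: "d \<subseteq> S" "inj_on p d" "e = p ` d"
      by (meson subset_image_inj)
    then have "d \<in> [S]\<^bsup>q\<^esup>"
      using e by (auto simp: nsets_def card_image finite_image_iff)
    then show "f e = \<xi>" using hom d by (auto simp: col)
  qed
  have fibre: "card (F a) < L" for a
  proof -
    have inj: "inj_on (\<lambda>x. x mod M) (F a)"
      by (rule inj_onI) (metis (mono_tags, lifting) F_def div_mult_mod_eq mem_Collect_eq p_def)
    have "card ((\<lambda>x. x mod M) ` F a) < L"
    proof (rule homogeneous_belowD[OF f])
      show "(\<lambda>x. x mod M) ` F a \<subseteq> {..<M}" using M by (auto simp: F_def)
      fix e assume e: "e \<in> [(\<lambda>x. x mod M) ` F a]\<^bsup>q\<^esup>"
      then obtain d where d: "d \<subseteq> F a" "e = (\<lambda>x. x mod M) ` d"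
        by (auto simp: nsets_def subset_image_iff)
      have "inj_on (\<lambda>x. x mod M) d" using inj d(1) by (rule inj_on_subset)
      then have cd: "finite d" "card d = q"
        using e d by (auto simp: nsets_def card_image finite_image_iff)
      then have "d \<noteq> {}" using \<open>q \<ge> 3\<close> by auto
      then have im: "p ` d = {a}" using d(1) by (auto simp: F_def)
      then have "\<not> inj_on p d" using cd \<open>q \<ge> 3\<close> card_image by fastforce
      moreover have "d \<in> [S]\<^bsup>q\<^esup>" using cd d(1) by (auto simp: nsets_def F_def)
      ultimately show "f e = \<xi>" using hom d(2) im by (auto simp: col)
    qed
    then show ?thesis by (simp add: card_image inj)
  qed
  have large_fibre: "a = b" if a: "q - 1 \<le> card (F a)" and b: "q - 1 \<le> card (F b)" for a b
  proof (rule ccontr)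
    assume "a \<noteq> b"
    \<comment> \<open>A \<open>q\<close>-set that meets exactly two fibres is neither injective
      under \<open>p\<close>, because \<open>q \<ge> 3\<close>, nor inside one fibre. So its colour
      is read off from the size of its lower part.\<close>
    have mixed: "product_colouring M f (P \<union> R) = (card P \<ge> 2)" "P \<union> R \<in> [S]\<^bsup>q\<^esup>"
      if c: "c < d" and P: "P \<subseteq> F c" "card P = m" and R: "R \<subseteq> F d" "card R = r"
        and mr: "m > 0" "r > 0" "m + r = q" for c d P R m r
    proof -
      have finPR: "finite P" "finite R" using P R finF finite_subset by blast+
      have ne: "P \<noteq> {}" "R \<noteq> {}" using P R mr by auto
      have im: "p ` (P \<union> R) = {c, d}" using P R ne by (auto simp: F_def)
      have "P \<inter> R = {}" using P R c by (auto simp: F_def)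
      then have card: "card (P \<union> R) = q" using finPR P R mr by (simp add: card_Un_disjoint)
      show "P \<union> R \<in> [S]\<^bsup>q\<^esup>" using card finPR P R by (auto simp: nsets_def F_def)
      have "card (p ` (P \<union> R)) = 2" using im c by simp
      then have "\<not> inj_on p (P \<union> R)" using card \<open>q \<ge> 3\<close> card_image by fastforce
      moreover have "Min (p ` (P \<union> R)) = c" using im c by simp
      moreover have "{x \<in> P \<union> R. p x = c} = P" using P R c by (auto simp: F_def)
      ultimately show "product_colouring M f (P \<union> R) = (card P \<ge> 2)"
        using \<open>card (p ` (P \<union> R)) = 2\<close> by (simp add: col)
    qed
    obtain c d where cd: "c < d" "q - 1 \<le> card (F c)" "q - 1 \<le> card (F d)"
      using a b \<open>a \<noteq> b\<close> by (meson linorder_neqE_nat)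
    obtain P1 where P1: "P1 \<subseteq> F c" "card P1 = q - 1" using cd obtain_subset_with_card_n by meson
    obtain R1 where R1: "R1 \<subseteq> F d" "card R1 = q - 1" using cd obtain_subset_with_card_n by meson
    have "1 \<le> card (F c)" "1 \<le> card (F d)" using cd \<open>q \<ge> 3\<close> by auto
    then obtain P2 R2 where P2: "P2 \<subseteq> F c" "card P2 = 1" and R2: "R2 \<subseteq> F d" "card R2 = 1"
      using obtain_subset_with_card_n by meson
    \<comment> \<open>The lower parts have \<open>q - 1 \<ge> 2\<close> points and 1 point
      respectively.\<close>
    have "product_colouring M f (P1 \<union> R2) \<noteq> product_colouring M f (P2 \<union> R1)"
      using mixed(1)[OF cd(1) P1 R2] mixed(1)[OF cd(1) P2 R1] P1 P2 \<open>q \<ge> 3\<close> by simp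
    moreover have "P1 \<union> R2 \<in> [S]\<^bsup>q\<^esup>" "P2 \<union> R1 \<in> [S]\<^bsup>q\<^esup>"
      using mixed(2)[OF cd(1) P1 R2] mixed(2)[OF cd(1) P2 R1] \<open>q \<ge> 3\<close> by simp_all
    ultimately show False using hom by blast
  qed
  obtain a where a: "\<And>b. b \<noteq> a \<Longrightarrow> card (F b) \<le> q - 2"
  proof (cases "\<exists>a. q - 1 \<le> card (F a)")
    case True
    then obtain a where "q - 1 \<le> card (F a)" by blast
    then have "\<not> q - 1 \<le> card (F b)" if "b \<noteq> a" for b using large_fibre that by blast
    then have "card (F b) \<le> q - 2" if "b \<noteq> a" for b using that by fastforce
    then show ?thesis by (rule that)
  next
    case False
    have "card (F b) \<le> q - 2" for b using False[simplified, rule_format, of b] by linarith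
    then show ?thesis using that by blast
  qed
  have "S = (\<Union>b\<in>p ` S. F b)" by (auto simp: F_def)
  then have "card S \<le> (\<Sum>b\<in>p ` S. card (F b))"
    using card_UN_le[of "p ` S" F] fin by simp
  \<comment> \<open>The exceptional fibre \<open>a\<close> is charged an extra \<open>L\<close>,
    every other fibre only \<open>q - 2\<close>.\<close>
  also have "\<dots> \<le> (\<Sum>b\<in>p ` S. (q - 2) + (if b = a then L else 0))"
    using a fibre by (intro sum_mono) (auto simp: less_imp_le trans_le_add2)
  also have "\<dots> \<le> card (p ` S) * (q - 2) + L"
    using fin by (simp add: sum.distrib)
  also have "\<dots> \<le> L * (q - 2) + L" using proj by simp
  also have "\<dots> = L * (q - 1)" 
  proof -
    have "q - 1 = Suc (q - 2)" using \<open>q \<ge> 3\<close> by simp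
    then show ?thesis by simp
  qed
  also have "\<dots> < q * L" using \<open>q \<ge> 3\<close> \<open>L > 0\<close> by (simp add: mult.commute)
  finally show "card S < q * L" .
qed

lemma homogeneous_below_power:
  fixes M :: nat
  assumes "homogeneous_below f q {..<M} L" "q \<ge> 3"
  shows "\<exists>g. homogeneous_below g q {..<M ^ 2 ^ s} (q ^ s * L)"
proof (induction s)
  case 0
  then show ?case using assms(1) by (intro exI[of _ f]) (simp only: power_0 power_one_right mult_1)
next
  case (Suc s)
  then obtain g where "homogeneous_below g q {..<M ^ 2 ^ s} (q ^ s * L)" by blast
  from homogeneous_below_product[OF this assms(2)] show ?case
    by (auto simp: mult.assoc mult_2 simp flip: power_add)
qed

section \<open>Stepping up\<close>

text \<open>The index of the highest binary digit in which \<open>x\<close> and \<open>y\<close> differ (and \<open>0\<close> if \<open>x = y\<close>).\<close>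

definition level :: "nat \<Rightarrow> nat \<Rightarrow> nat" where
  "level x y = (LEAST j. x div 2 ^ Suc j = y div 2 ^ Suc j)"

text \<open>Agreement above digit \<open>j\<close> persists for every larger \<open>j\<close>, so
  the least such \<open>j\<close> determines all of them. The index \<open>x + y\<close> shows that
  one exists.\<close>

lemma level_le_iff: "level x y \<le> j \<longleftrightarrow> x div 2 ^ Suc j = y div 2 ^ Suc j"
proof -
  have "x < 2 ^ Suc (x + y)" "y < 2 ^ Suc (x + y)"
    using less_exp[of "x + y"] unfolding power_Suc by linarith+
  then have "x div 2 ^ Suc (x + y) = y div 2 ^ Suc (x + y)" by (simp only: div_less)
  then have *: "x div 2 ^ Suc (level x y) = y div 2 ^ Suc (level x y)"
    unfolding level_def by (rule LeastI)
  show ?thesis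
  proof
    assume "level x y \<le> j"
    then have "(2::nat) ^ Suc j = 2 ^ Suc (level x y) * 2 ^ (j - level x y)"
      by (simp flip: power_add)
    then show "x div 2 ^ Suc j = y div 2 ^ Suc j"
      using * by (simp only: div_mult2_eq)
  next
    assume "x div 2 ^ Suc j = y div 2 ^ Suc j"
    then show "level x y \<le> j" unfolding level_def by (rule Least_le)
  qed
qed

lemma level_commute: "level x y = level y x"
  by (simp add: level_def eq_commute)

lemma level_less: "x < 2 ^ N \<Longrightarrow> y < 2 ^ N \<Longrightarrow> x \<noteq> y \<Longrightarrow> level x y < N"
proof (cases N)
  case (Suc m)
  assume "x < 2 ^ N" "y < 2 ^ N"
  then show ?thesis unfolding Suc less_Suc_eq_le level_le_iff by simp
qed simp

text \<open>Truncation is monotone and \<open>y\<close> lies between \<open>x\<close> and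
  \<open>z\<close>: if the truncations of \<open>x\<close> and \<open>z\<close> agree, that of
  \<open>y\<close> agrees with both.\<close>

lemma level_max:
  assumes "x < y" "y < z"
  shows "level x z = max (level x y) (level y z)"
proof -
  have "level x z \<le> j \<longleftrightarrow> level x y \<le> j \<and> level y z \<le> j" for j
    using div_le_mono[of x y "2 ^ Suc j"] div_le_mono[of y z "2 ^ Suc j"] assms
    unfolding level_le_iff by linarith
  then show ?thesis by (metis max.bounded_iff order_antisym order_refl)
qed

text \<open>If both levels were \<open>j\<close>, the three numbers would agree above digit
  \<open>j\<close> and yet have three distinct truncations at \<open>j\<close>, while a binary digit
  takes only two values.\<close>

lemma level_neq:
  assumes "x < y" "y < z"
  shows "level x y \<noteq> level y z"
proof
  assume eq: "level x y = level y z"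
  define j where "j = level x y"
  have top: "x div 2 ^ j div 2 = z div 2 ^ j div 2"
    using level_le_iff[of x y j] level_le_iff[of y z j] eq
    by (simp add: j_def div_mult2_eq[symmetric] mult.commute)
  have "u div 2 ^ j \<noteq> v div 2 ^ j" if "u < v" "level u v = j" for u v
  proof (cases j)
    case (Suc i)
    then show ?thesis using that level_le_iff[of u v i] by simp
  qed (use that in simp)
  then have "x div 2 ^ j \<noteq> y div 2 ^ j" "y div 2 ^ j \<noteq> z div 2 ^ j"
    using assms eq by (simp_all add: j_def)
  moreover have "x div 2 ^ j \<le> y div 2 ^ j" "y div 2 ^ j \<le> z div 2 ^ j"
    using assms by (simp_all add: div_le_mono)
  ultimately show False using top by linarith
qed

section \<open>The step-up colouring and its invariance under level-preserving maps\<close>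

definition levels :: "nat set \<Rightarrow> nat set" where
  "levels e = {level x y | x y. x \<in> e \<and> y \<in> e \<and> x \<noteq> y}"

definition first_four :: "nat set \<Rightarrow> nat \<Rightarrow> nat \<Rightarrow> nat \<Rightarrow> nat \<Rightarrow> bool" where
  "first_four e a b c d \<longleftrightarrow>
     {a, b, c, d} \<subseteq> e \<and> a < b \<and> b < c \<and> c < d \<and> (\<forall>y\<in>e - {a, b, c, d}. d < y)"

definition peak :: "nat set \<Rightarrow> bool" where
  "peak e \<longleftrightarrow> (\<exists>a b c d. first_four e a b c d \<and> level a b < level b c \<and> level c d < level b c)"

definition valley :: "nat set \<Rightarrow> bool" where
  "valley e \<longleftrightarrow> (\<exists>a b c d. first_four e a b c d \<and> level b c < level a b \<and> level b c < level c d)"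

text \<open>Peaks are \<open>True\<close> and valleys \<open>False\<close>, so a homogeneous set
  must avoid one of the two patterns; \<open>h\<close> decides the rest. On a (q+1)-set whose levels
  are monotone, \<open>levels e\<close> has exactly \<open>q\<close> elements.\<close>

definition step_up :: "(nat set \<Rightarrow> bool) \<Rightarrow> nat set \<Rightarrow> bool" where
  "step_up h e \<longleftrightarrow> peak e \<or> \<not> valley e \<and> h (levels e)"

lemma first_four_unique:
  assumes "first_four e a b c d" "first_four e a' b' c' d'"
  shows "a = a' \<and> b = b' \<and> c = c' \<and> d = d'"
proof -
  have *: "x = p \<or> x = q \<or> x = r \<or> x = s \<or> s < x" if "first_four e p q r s" "x \<in> e" for p q r s x
    using that unfolding first_four_def by blast
  have m: "a \<in> e" "b \<in> e" "c \<in> e" "d \<in> e" "a' \<in> e" "b' \<in> e" "c' \<in> e" "d' \<in> e"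
    and l: "a < b" "b < c" "c < d" "a' < b'" "b' < c'" "c' < d'"
    using assms unfolding first_four_def by auto
  have "a = a'" using *[OF assms(2) m(1)] *[OF assms(1) m(5)] l by linarith
  moreover have "b = b'" using *[OF assms(2) m(2)] *[OF assms(1) m(6)] l calculation by linarith
  moreover have "c = c'" using *[OF assms(2) m(3)] *[OF assms(1) m(7)] l calculation by linarith
  moreover have "d = d'" using *[OF assms(2) m(4)] *[OF assms(1) m(8)] l calculation by linarith
  ultimately show ?thesis by simp
qed

text \<open>The definition gives peaks precedence. A valley is not a peak, because the first four
  elements are unique.\<close>

lemma step_up_valley: "valley e \<Longrightarrow> \<not> step_up h e"
proof -
  assume "valley e"
  then obtain a b c d where v: "first_four e a b c d" "level b c < level a b"
    unfolding valley_def by blast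
  have "\<not> peak e"
  proof
    assume "peak e"
    then obtain a' b' c' d' where p: "first_four e a' b' c' d'" "level a' b' < level b' c'"
      unfolding peak_def by blast
    then show False using first_four_unique[OF v(1) p(1)] v(2) by simp
  qed
  then show ?thesis using \<open>valley e\<close> unfolding step_up_def by blast
qed

lemma first_four_image:
  assumes "first_four e a b c d" and mono: "strict_mono_on e \<phi>"
  shows "first_four (\<phi> ` e) (\<phi> a) (\<phi> b) (\<phi> c) (\<phi> d)"
proof -
  have e: "a \<in> e" "b \<in> e" "c \<in> e" "d \<in> e" "a < b" "b < c" "c < d" "\<forall>y\<in>e - {a, b, c, d}. d < y"
    using assms(1) unfolding first_four_def by auto
  then have "\<phi> a < \<phi> b" "\<phi> b < \<phi> c" "\<phi> c < \<phi> d" using strict_mono_onD[OF mono] by auto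
  moreover have "\<phi> d < y" if "y \<in> \<phi> ` e - {\<phi> a, \<phi> b, \<phi> c, \<phi> d}" for y
  proof -
    from that obtain x where x: "y = \<phi> x" "x \<in> e - {a, b, c, d}" by blast
    then show ?thesis using strict_mono_onD[OF mono] e by auto
  qed
  ultimately show ?thesis using e unfolding first_four_def by blast
qed

text \<open>These are the three data from which \<open>step_up\<close> is computed. The converse
  implications for peaks and valleys come from applying the lemma to the inverse exchange.\<close>

lemma level_patterns_image:
  assumes mono: "strict_mono_on e \<phi>"
    and lev: "\<And>a b. a \<in> e \<Longrightarrow> b \<in> e \<Longrightarrow> a \<noteq> b \<Longrightarrow> level (\<phi> a) (\<phi> b) = level a b"
  shows "peak e \<Longrightarrow> peak (\<phi> ` e)" "valley e \<Longrightarrow> valley (\<phi> ` e)" "levels (\<phi> ` e) = levels e"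
proof -
  have lev4: "level (\<phi> a) (\<phi> b) = level a b \<and> level (\<phi> b) (\<phi> c) = level b c
      \<and> level (\<phi> c) (\<phi> d) = level c d" if "first_four e a b c d" for a b c d
  proof -
    have "a \<in> e" "b \<in> e" "c \<in> e" "d \<in> e" "a \<noteq> b" "b \<noteq> c" "c \<noteq> d"
      using that unfolding first_four_def by auto
    then show ?thesis using lev by blast
  qed
  show "peak (\<phi> ` e)" if "peak e"
  proof -
    from that obtain a b c d where f: "first_four e a b c d" "level a b < level b c" "level c d < level b c"
      unfolding peak_def by blast
    then show ?thesis
      using lev4[OF f(1)] first_four_image[OF f(1) mono] unfolding peak_def
      by (intro exI[of _ "\<phi> a"] exI[of _ "\<phi> b"] exI[of _ "\<phi> c"] exI[of _ "\<phi> d"]) simp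
  qed
  show "valley (\<phi> ` e)" if "valley e"
  proof -
    from that obtain a b c d where f: "first_four e a b c d" "level b c < level a b" "level b c < level c d"
      unfolding valley_def by blast
    then show ?thesis
      using lev4[OF f(1)] first_four_image[OF f(1) mono] unfolding valley_def
      by (intro exI[of _ "\<phi> a"] exI[of _ "\<phi> b"] exI[of _ "\<phi> c"] exI[of _ "\<phi> d"]) simp
  qed
  have "inj_on \<phi> e" using mono by (rule strict_mono_on_imp_inj_on)
  then have neq: "\<phi> a \<noteq> \<phi> b \<longleftrightarrow> a \<noteq> b" if "a \<in> e" "b \<in> e" for a b
    using that by (auto dest: inj_onD)
  show "levels (\<phi> ` e) = levels e"
  proof (intro subset_antisym subsetI)
    fix t assume "t \<in> levels (\<phi> ` e)"
    then obtain a b where "a \<in> e" "b \<in> e" "\<phi> a \<noteq> \<phi> b" "t = level (\<phi> a) (\<phi> b)"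
      unfolding levels_def by blast
    then have "a \<noteq> b" by blast
    then have "t = level a b" using lev \<open>a \<in> e\<close> \<open>b \<in> e\<close> \<open>t = level (\<phi> a) (\<phi> b)\<close> by simp
    then show "t \<in> levels e" unfolding levels_def using \<open>a \<in> e\<close> \<open>b \<in> e\<close> \<open>a \<noteq> b\<close> by blast
  next
    fix t assume "t \<in> levels e"
    then obtain a b where "a \<in> e" "b \<in> e" "a \<noteq> b" "t = level a b"
      unfolding levels_def by blast
    then have "t = level (\<phi> a) (\<phi> b)" "\<phi> a \<noteq> \<phi> b" using lev neq by simp_all
    then show "t \<in> levels (\<phi> ` e)" unfolding levels_def using \<open>a \<in> e\<close> \<open>b \<in> e\<close> by blast
  qed
qed

section \<open>Twins\<close>

definition twins :: "nat set \<Rightarrow> nat \<Rightarrow> nat \<Rightarrow> bool" where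
  "twins X x y \<longleftrightarrow> (\<forall>z\<in>X - {x, y}. level x z = level y z \<and> (z < x \<longleftrightarrow> z < y))"

lemma twins_commute: "twins X x y \<Longrightarrow> twins X y x"
  by (auto simp: twins_def)

text \<open>The map that sends \<open>x\<close> to \<open>y\<close> and fixes \<open>S\<close>
  preserves order and levels, hence the colour.\<close>

lemma step_up_twins:
  assumes "twins X x y" "S \<subseteq> X - {x, y}"
  shows "step_up h (insert x S) = step_up h (insert y S)"
proof -
  have image: "(peak (insert x S) \<longrightarrow> peak (insert y S)) \<and> (valley (insert x S) \<longrightarrow> valley (insert y S)) \<and>
      levels (insert y S) = levels (insert x S)"
    if tw: "twins X x y" and S: "S \<subseteq> X - {x, y}" for x y
  proof -
    define \<phi> where "\<phi> z = (if z = x then y else z)" for z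
    have tw': "level x z = level y z" "level z x = level z y" "z < x \<longleftrightarrow> z < y" "z \<noteq> x" "z \<noteq> y"
      if "z \<in> S" for z
      using tw S that unfolding twins_def by (auto simp: level_commute)
    have "strict_mono_on (insert x S) \<phi>"
    proof (rule strict_mono_onI)
      fix a b assume ab: "a \<in> insert x S" "b \<in> insert x S" "a < b"
      then consider "a = x" "b \<in> S" | "a \<in> S" "b = x" | "a \<in> S" "b \<in> S" by auto
      then show "\<phi> a < \<phi> b"
      proof cases
        case 1
        then show ?thesis using tw'(3-5)[OF 1(2)] ab(3) by (auto simp: \<phi>_def)
      next
        case 2
        then show ?thesis using tw'(3-5)[OF 2(1)] ab(3) by (auto simp: \<phi>_def)
      next
        case 3
        then show ?thesis using tw'(4)[OF 3(1)] tw'(4)[OF 3(2)] ab(3) by (simp add: \<phi>_def)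
      qed
    qed
    moreover have "level (\<phi> a) (\<phi> b) = level a b"
      if ab: "a \<in> insert x S" "b \<in> insert x S" "a \<noteq> b" for a b
    proof -
      consider "a = x" "b \<in> S" | "a \<in> S" "b = x" | "a \<in> S" "b \<in> S" using ab by auto
      then show ?thesis
      proof cases
        case 1
        then show ?thesis using tw'(1,4)[OF 1(2)] by (simp add: \<phi>_def)
      next
        case 2
        then show ?thesis using tw'(2,4)[OF 2(1)] by (simp add: \<phi>_def)
      next
        case 3
        then show ?thesis using tw'(4)[OF 3(1)] tw'(4)[OF 3(2)] by (simp add: \<phi>_def)
      qed
    qed
    moreover have "\<phi> ` insert x S = insert y S"
      using tw'(4) unfolding \<phi>_def by force
    ultimately show ?thesis using level_patterns_image[of "insert x S" \<phi>] by auto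
  qed
  \<comment> \<open>Twins are symmetric, so the one-sided transfer in both directions yields
    equivalence.\<close>
  have "S \<subseteq> X - {y, x}" using assms(2) by blast
  with image[OF assms] image[OF twins_commute[OF assms(1)]] show ?thesis
    unfolding step_up_def by auto
qed

lemma ex_minimal_level:
  assumes "finite X" "card X \<ge> 2"
  obtains x y where "x \<in> X" "y \<in> X" "x < y"
    "\<And>a b. a \<in> X \<Longrightarrow> b \<in> X \<Longrightarrow> a < b \<Longrightarrow> level x y \<le> level a b"
proof -
  obtain u v where uv: "u \<in> X" "v \<in> X" "u \<noteq> v"
    using assms by (metis card_le_Suc0_iff_eq not_less_eq_eq numeral_2_eq_2)
  define P where "P = (\<lambda>(x, y). x \<in> X \<and> y \<in> X \<and> x < (y::nat))"
  have "P (min u v, max u v)" using uv by (auto simp: P_def min_def max_def)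
  from ex_has_least_nat[of P, OF this, of "\<lambda>(x, y). level x y"] show ?thesis
    using that unfolding P_def by auto
qed

text \<open>A pair \<open>x < y\<close> of minimal level works: by \<open>level_max\<close>, the
  level from an outside point \<open>z\<close> to the farther of the two equals that to the nearer
  one.\<close>

lemma ex_twins:
  assumes "finite X" "card X \<ge> 2"
  obtains x y where "x \<in> X" "y \<in> X" "x < y" "twins X x y"
proof -
  obtain x y where
    xy: "x \<in> X" "y \<in> X" "x < y" and
    min: "\<And>a b. a \<in> X \<Longrightarrow> b \<in> X \<Longrightarrow> a < b \<Longrightarrow> level x y \<le> level a b"
    using ex_minimal_level[OF assms] by blast
  have "twins X x y"
    unfolding twins_def
  proof
    fix z assume "z \<in> X - {x, y}"
    then have z: "z \<in> X" "z \<noteq> x" "z \<noteq> y" by auto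
    then consider "z < x" | "x < z" "z < y" | "y < z" by linarith
    then show "level x z = level y z \<and> (z < x \<longleftrightarrow> z < y)"
    proof cases
      case 1
      then have "level z y = level z x"
        using level_max[OF 1 xy(3)] min[OF z(1) xy(1) 1] by simp
      then show ?thesis using 1 xy(3) by (simp add: level_commute)
    next
      \<comment> \<open>No point lies strictly between: its levels to \<open>x\<close> and
        \<open>y\<close> would differ, and the smaller one would be below their maximum
        \<open>level x y\<close>, against minimality.\<close>
      case 2
      then show ?thesis
        using level_max[OF 2] level_neq[OF 2] min[OF xy(1) z(1)] min[OF z(1) xy(2)] by simp
    next
      case 3
      then show ?thesis
        using level_max[OF xy(3) 3] min[OF xy(2) z(1) 3] xy(3) by simp
    qed
  qed
  with xy show ?thesis using that by blast
qed

section \<open>Homogeneous sets of the step-up colouring\<close>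

lemma card_comb_le:
  assumes h: "homogeneous_below h q {..<N} L"
    and T: "T \<subseteq> {..<2 ^ N}" "p \<in> T"
    and hom: "\<And>e. e \<in> [T]\<^bsup>Suc q\<^esup> \<Longrightarrow> step_up h e = \<xi>"
    and flat: "\<And>e. e \<subseteq> T \<Longrightarrow> \<not> peak e \<and> \<not> valley e"
    and comb: "\<And>x y. x \<in> T - {p} \<Longrightarrow> y \<in> T - {p} \<Longrightarrow> x < y \<Longrightarrow>
      level x p \<noteq> level y p \<and> level x y \<in> {level x p, level y p}"
  shows "card T \<le> L"
proof -
  \<comment> \<open>The levels to the base point \<open>p\<close> are pairwise distinct and already
    include every level between other points. So adding \<open>p\<close> to a \<open>q\<close>-set
    \<open>d\<close> gives a (q+1)-set whose levels are exactly the \<open>w\<close>-values on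
    \<open>d\<close>. Without peaks and valleys its colour is the \<open>h\<close>-colour of these
    values, so the image of \<open>w\<close> is homogeneous for \<open>h\<close>.\<close>
  define w where "w x = level x p" for x
  have fin: "finite T" using T(1) finite_subset by blast
  have "w x \<noteq> w y" if "x \<in> T - {p}" "y \<in> T - {p}" "x \<noteq> y" for x y
    using comb[of x y] comb[of y x] that unfolding w_def by (metis linorder_neqE_nat)
  then have inj: "inj_on w (T - {p})" unfolding inj_on_def by blast
  have comb': "level x y \<in> {w x, w y}" if "x \<in> T - {p}" "y \<in> T - {p}" "x \<noteq> y" for x y
    using comb[of x y] comb[of y x] that level_commute[of x y] unfolding w_def
    by (cases x y rule: linorder_cases) auto
  have "card (w ` (T - {p})) < L"
  proof (rule homogeneous_belowD[OF h])
    show "w ` (T - {p}) \<subseteq> {..<N}"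
      using T level_less[of _ N p] unfolding w_def by blast
    fix e assume e: "e \<in> [w ` (T - {p})]\<^bsup>q\<^esup>"
    then have "e \<subseteq> w ` (T - {p})" by (simp add: nsets_def)
    then obtain d where d: "d \<subseteq> T - {p}" "e = w ` d" by (meson subset_imageE)
    have "inj_on w d" using inj d(1) by (rule inj_on_subset)
    then have "finite d" "card d = q"
      using e d by (auto simp: nsets_def card_image finite_image_iff)
    then have pd: "insert p d \<in> [T]\<^bsup>Suc q\<^esup>" using d(1) T(2) by (auto simp: nsets_def card_insert_if)
    have "levels (insert p d) = e"
    proof (intro subset_antisym subsetI)
      fix t assume "t \<in> levels (insert p d)"
      then obtain x y where xy: "t = level x y" "x \<in> insert p d" "y \<in> insert p d" "x \<noteq> y"
        unfolding levels_def by blast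
      then consider "x = p" "y \<in> d" | "y = p" "x \<in> d" | "x \<in> d" "y \<in> d" by blast
      then show "t \<in> e"
      proof cases
        case 1
        then show ?thesis using xy(1) d(2) level_commute[of x y] by (simp add: w_def)
      next
        case 2
        then show ?thesis using xy(1) d(2) by (simp add: w_def)
      next
        case 3
        then show ?thesis using comb'[of x y] xy d by blast
      qed
    next
      fix t assume "t \<in> e"
      then obtain x where "x \<in> d" "t = level x p" using d(2) by (auto simp: w_def)
      then show "t \<in> levels (insert p d)" using d(1) unfolding levels_def by blast
    qed
    moreover have "insert p d \<subseteq> T" using pd by (simp add: nsets_def)
    ultimately show "h e = \<xi>" using hom[OF pd] flat unfolding step_up_def by blast
  qed
  then have "card (T - {p}) < L" by (simp add: card_image inj)
  then show ?thesis using T(2) fin by (simp add: card_Diff_singleton)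
qed

definition levels_increasing :: "nat set \<Rightarrow> bool" where
  "levels_increasing T \<longleftrightarrow> (\<forall>a\<in>T. \<forall>b\<in>T. \<forall>c\<in>T. a < b \<longrightarrow> b < c \<longrightarrow> level a b < level b c)"

definition levels_decreasing :: "nat set \<Rightarrow> bool" where
  "levels_decreasing T \<longleftrightarrow> (\<forall>a\<in>T. \<forall>b\<in>T. \<forall>c\<in>T. a < b \<longrightarrow> b < c \<longrightarrow> level b c < level a b)"

lemma levels_increasingD:
  "levels_increasing T \<Longrightarrow> a \<in> T \<Longrightarrow> b \<in> T \<Longrightarrow> c \<in> T \<Longrightarrow> a < b \<Longrightarrow> b < c \<Longrightarrow> level a b < level b c"
  by (simp add: levels_increasing_def)

lemma levels_decreasingD:
  "levels_decreasing T \<Longrightarrow> a \<in> T \<Longrightarrow> b \<in> T \<Longrightarrow> c \<in> T \<Longrightarrow> a < b \<Longrightarrow> b < c \<Longrightarrow> level b c < level a b"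
  by (simp add: levels_decreasing_def)

text \<open>The base point is the maximum: for \<open>x < y < p\<close> the later level
  \<open>level y p\<close> is the smaller one, so \<open>level x p = level x y\<close>.\<close>

lemma card_decreasing_le:
  assumes h: "homogeneous_below h q {..<N} L" and T: "T \<subseteq> {..<2 ^ N}"
    and hom: "\<And>e. e \<in> [T]\<^bsup>Suc q\<^esup> \<Longrightarrow> step_up h e = \<xi>"
    and "levels_decreasing T"
  shows "card T \<le> L"
proof (cases "T = {}")
  case False
  note dec = levels_decreasingD[OF assms(4)]
  have fin: "finite T" using T finite_subset by blast
  define p where "p = Max T"
  have p: "p \<in> T" "\<And>x. x \<in> T - {p} \<Longrightarrow> x < p"
    using fin False Max_in[of T] Max_ge[of T] by (auto simp: p_def order_less_le)
  show ?thesis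
  proof (rule card_comb_le[OF h T p(1) hom])
    show "\<not> peak e \<and> \<not> valley e" if "e \<subseteq> T" for e
      using dec that unfolding peak_def valley_def first_four_def
      by (meson insert_subset less_asym subsetD)
    fix x y assume xy: "x \<in> T - {p}" "y \<in> T - {p}" "x < y"
    have "level y p < level x y" using dec[of x y p] xy p by simp
    moreover have "level x p = max (level x y) (level y p)" using xy p level_max by blast
    ultimately show "level x p \<noteq> level y p \<and> level x y \<in> {level x p, level y p}" by simp
  qed
qed simp

text \<open>Mirror image with the minimum as base point: for \<open>p < x < y\<close> one has
  \<open>level p y = level x y\<close>.\<close>

lemma card_increasing_le:
  assumes h: "homogeneous_below h q {..<N} L" and T: "T \<subseteq> {..<2 ^ N}"
    and hom: "\<And>e. e \<in> [T]\<^bsup>Suc q\<^esup> \<Longrightarrow> step_up h e = \<xi>"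
    and "levels_increasing T"
  shows "card T \<le> L"
proof (cases "T = {}")
  case False
  note inc = levels_increasingD[OF assms(4)]
  have fin: "finite T" using T finite_subset by blast
  define p where "p = Min T"
  have p: "p \<in> T" "\<And>x. x \<in> T - {p} \<Longrightarrow> p < x"
    using fin False Min_in[of T] Min_le[of T] by (auto simp: p_def order_less_le)
  show ?thesis
  proof (rule card_comb_le[OF h T p(1) hom])
    show "\<not> peak e \<and> \<not> valley e" if "e \<subseteq> T" for e
      using inc that unfolding peak_def valley_def first_four_def
      by (meson insert_subset less_asym subsetD)
    fix x y assume xy: "x \<in> T - {p}" "y \<in> T - {p}" "x < y"
    have "level p x < level x y" using inc[of p x y] xy p by simp
    moreover have "level p y = max (level p x) (level x y)" using xy p level_max by blast
    ultimately show "level x p \<noteq> level y p \<and> level x y \<in> {level x p, level y p}"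
      by (simp add: level_commute[of _ p])
  qed
qed simp

text \<open>The set is cut at its highest branching level \<open>D\<close>, which separates the
  minimum \<open>m\<close> from the maximum \<open>z\<close>. The lower half has increasing and the
  upper half decreasing levels.\<close>

lemma valley_free_split:
  assumes "finite S"
    and free: "\<And>a b c d. {a, b, c, d} \<subseteq> S \<Longrightarrow> a < b \<Longrightarrow> b < c \<Longrightarrow> c < d \<Longrightarrow>
      level b c < level a b \<Longrightarrow> \<not> level b c < level c d"
  obtains P R where "S = P \<union> R"
    "levels_increasing P" "levels_decreasing R"
proof (cases "S = {}")
  case False
  define m where "m = Min S"
  define z where "z = Max S"
  have m: "m \<in> S" "\<And>x. x \<in> S \<Longrightarrow> m \<le> x" using assms(1) False by (auto simp: m_def)
  have z: "z \<in> S" "\<And>x. x \<in> S \<Longrightarrow> x \<le> z" using assms(1) False by (auto simp: z_def)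
  define D where "D = level m z"
  define R where "R = {s \<in> S. m < s \<and> level m s = D}"
  have le: "level m s \<le> D" if "s \<in> S" "m < s" for s
    using that z(2)[OF that(1)] level_max[of m s z] by (cases "s = z") (auto simp: D_def)
  show ?thesis
  proof (rule that[of "S - R" R])
    show "S = (S - R) \<union> R" by (auto simp: R_def)
  next
    show "levels_increasing (S - R)"
      unfolding levels_increasing_def
    proof (intro ballI impI)
      fix a b c assume abc: "a \<in> S - R" "b \<in> S - R" "c \<in> S - R" "a < b" "b < c"
      have mab: "m \<le> a" using m(2) abc by blast
      have mc: "level m c < D" using abc mab le[of c] by (auto simp: R_def order_less_le)
      then have "c \<noteq> z" by (auto simp: D_def)
      then have "c < z" using z(2)[of c] abc by simp
      have "level c z = D"
        using level_max[of m c z] mc \<open>c < z\<close> mab abc by (auto simp: D_def max_def split: if_splits)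
      moreover have "level b c < D" using level_max[of m b c] mc mab abc by simp
      \<comment> \<open>Otherwise \<open>a\<close>, \<open>b\<close>, \<open>c\<close>,
        \<open>z\<close> form a valley, since the last level \<open>D\<close> exceeds
        \<open>level b c\<close>.\<close>
      ultimately have "\<not> level b c < level a b"
        using free[of a b c z] abc z(1) \<open>c < z\<close> by auto
      then show "level a b < level b c" using level_neq[OF abc(4,5)] by simp
    qed
  next
    show "levels_decreasing R"
      unfolding levels_decreasing_def
    proof (intro ballI impI)
      fix a b c assume abc: "a \<in> R" "b \<in> R" "c \<in> R" "a < b" "b < c"
      then have "level m a = D" "level m b = D" "m < a" by (auto simp: R_def)
      then have "level a b < D" using level_max[of m a b] level_neq[of m a b] abc by simp
      \<comment> \<open>Otherwise \<open>m\<close>, \<open>a\<close>, \<open>b\<close>,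
        \<open>c\<close> form a valley, since the first level \<open>D\<close> exceeds
        \<open>level a b\<close>.\<close>
      then have "\<not> level a b < level b c"
        using free[of m a b c] abc m(1) \<open>level m a = D\<close> \<open>m < a\<close> by (auto simp: R_def)
      then show "level b c < level a b" using level_neq[OF abc(4,5)] by simp
    qed
  qed
qed (use that[of "{}" "{}"] in \<open>simp add: levels_increasing_def levels_decreasing_def\<close>)

text \<open>The set is cut at a pair \<open>x < y\<close> of minimal level, between which no point
  lies. Levels must rise away from this lowest branching on both sides.\<close>

lemma peak_free_split:
  assumes "finite S" "card S \<ge> 2"
    and free: "\<And>a b c d. {a, b, c, d} \<subseteq> S \<Longrightarrow> a < b \<Longrightarrow> b < c \<Longrightarrow> c < d \<Longrightarrow>
      level a b < level b c \<Longrightarrow> \<not> level c d < level b c"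
  obtains P R where "S = P \<union> R"
    "levels_increasing P" "levels_decreasing R"
proof -
  obtain x y where xy: "x \<in> S" "y \<in> S" "x < y" and
    min: "\<And>a b. a \<in> S \<Longrightarrow> b \<in> S \<Longrightarrow> a < b \<Longrightarrow> level x y \<le> level a b"
    using ex_minimal_level[OF assms(1,2)] by blast
  have gap: "\<not> (x < z \<and> z < y)" if "z \<in> S" for z
    using level_max[of x z y] level_neq[of x z y] min[OF xy(1) that] min[OF that xy(2)] by fastforce
  show ?thesis
  proof (rule that[of "{s \<in> S. y \<le> s}" "{s \<in> S. s \<le> x}"])
    show "S = {s \<in> S. y \<le> s} \<union> {s \<in> S. s \<le> x}" using gap by force
  next
    show "levels_increasing {s \<in> S. y \<le> s}"
      unfolding levels_increasing_def
    proof (intro ballI impI)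
      fix a b c assume "a \<in> {s \<in> S. y \<le> s}" "b \<in> {s \<in> S. y \<le> s}" "c \<in> {s \<in> S. y \<le> s}"
        and lt: "a < b" "b < c"
      then have abc: "a \<in> S" "b \<in> S" "c \<in> S" "y \<le> a" by auto
      \<comment> \<open>Replacing \<open>a\<close> by \<open>y\<close> only raises the level to
        \<open>b\<close>, so a fall after \<open>b\<close> would make \<open>x\<close>,
        \<open>y\<close>, \<open>b\<close>, \<open>c\<close> a peak.\<close>
      have "level a b \<le> level y b"
        using level_max[of y a b] abc(4) lt by (cases "y = a") auto
      moreover have "level x y < level y b"
        using min[of y b] level_neq[of x y b] xy abc lt by (simp add: order_less_le)
      ultimately have "\<not> level b c < level a b"
        using free[of x y b c] xy abc lt by auto
      then show "level a b < level b c" using level_neq[OF lt] by simp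
    qed
  next
    show "levels_decreasing {s \<in> S. s \<le> x}"
      unfolding levels_decreasing_def
    proof (intro ballI impI)
      fix a b c assume "a \<in> {s \<in> S. s \<le> x}" "b \<in> {s \<in> S. s \<le> x}" "c \<in> {s \<in> S. s \<le> x}"
        and lt: "a < b" "b < c"
      then have abc: "a \<in> S" "b \<in> S" "c \<in> S" "c \<le> x" by auto
      \<comment> \<open>Symmetrically, \<open>c\<close> is replaced by \<open>x\<close>, and a rise
        at \<open>b\<close> would make \<open>a\<close>, \<open>b\<close>, \<open>x\<close>,
        \<open>y\<close> a peak.\<close>
      have "level b c \<le> level b x"
        using level_max[of b c x] abc(4) lt by (cases "c = x") auto
      moreover have "level x y < level b x"
        using min[of b x] level_neq[of b x y] xy abc lt by (simp add: order_less_le)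
      ultimately have "\<not> level a b < level b c"
        using free[of a b x y] xy abc lt by auto
      then show "level b c < level a b" using level_neq[OF lt] by simp
    qed
  qed
qed

lemma obtain_top_elements:
  fixes S :: "'a :: linorder set"
  assumes "finite S" "r \<le> card S"
  obtains Q where "Q \<subseteq> S" "card Q = r" "\<And>x y. x \<in> S - Q \<Longrightarrow> y \<in> Q \<Longrightarrow> x < y"
  using assms(2)
proof (induction r arbitrary: thesis)
  case 0
  show ?case by (rule "0"(1)[of "{}"]) auto
next
  case (Suc r)
  obtain Q where Q: "Q \<subseteq> S" "card Q = r" "\<And>x y. x \<in> S - Q \<Longrightarrow> y \<in> Q \<Longrightarrow> x < y"
    using Suc by (metis Suc_leD)
  have "finite Q" using Q(1) assms(1) finite_subset by blast
  have "S - Q \<noteq> {}" using Q(2) Suc.prems(2) \<open>finite Q\<close> card_mono[of Q S] by fastforce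
  define v where "v = Max (S - Q)"
  have v: "v \<in> S - Q" "\<And>x. x \<in> S - Q \<Longrightarrow> x \<le> v"
    using \<open>S - Q \<noteq> {}\<close> assms(1) Max_in[of "S - Q"] Max_ge[of "S - Q"] by (auto simp: v_def)
  show ?case
  proof (rule Suc.prems(1))
    show "insert v Q \<subseteq> S" using Q v by blast
    show "card (insert v Q) = Suc r" using Q v \<open>finite Q\<close> by simp
    show "x < y" if "x \<in> S - insert v Q" "y \<in> insert v Q" for x y
      using that Q(3)[of x y] v(2)[of x] by (auto simp: order_less_le)
  qed
qed

text \<open>The \<open>q - 3\<close> largest points \<open>Q\<close> serve as padding: any four of
  the remaining points \<open>U\<close>, together with \<open>Q\<close>, form a (q+1)-set whose
  first four elements are these. Thus \<open>U\<close> avoids valleys or avoids peaks and splits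
  into two monotone parts of at most \<open>L\<close> points each, whereas the assumed size of
  \<open>S\<close> leaves at least \<open>2 * L + 4\<close> points in \<open>U\<close>.\<close>

lemma homogeneous_below_step_up:
  assumes h: "homogeneous_below h q {..<N} L" and "q \<ge> 3"
  shows "homogeneous_below (step_up h) (Suc q) {..<2 ^ N} (2 * L + Suc q)"
  unfolding homogeneous_below_def
proof (intro allI impI, rule ccontr)
  fix S \<xi>
  assume S: "S \<subseteq> {..<2 ^ N}" and hom: "\<forall>e\<in>[S]\<^bsup>Suc q\<^esup>. step_up h e = \<xi>"
    and "\<not> card S < 2 * L + Suc q"
  then have large: "2 * L + Suc q \<le> card S" by simp
  have fin: "finite S" using S finite_subset by blast
  from large have "q - 3 \<le> card S" by simp
  from obtain_top_elements[OF fin this] obtain Q where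
    Q: "Q \<subseteq> S" "card Q = q - 3" "\<And>x y. x \<in> S - Q \<Longrightarrow> y \<in> Q \<Longrightarrow> x < y"
    by blast
  define U where "U = S - Q"
  have "finite Q" using Q(1) fin finite_subset by blast
  then have "card U = card S - (q - 3)" using Q by (simp add: U_def card_Diff_subset)
  then have cardU: "2 * L < card U" "2 \<le> card U" using large \<open>q \<ge> 3\<close> by auto
  have "U \<subseteq> S" "finite U" using fin by (auto simp: U_def)
  have four: "first_four ({a, b, c, d} \<union> Q) a b c d" "{a, b, c, d} \<union> Q \<in> [S]\<^bsup>Suc q\<^esup>"
    if abcd: "{a, b, c, d} \<subseteq> U" "a < b" "b < c" "c < d" for a b c d
  proof -
    show "first_four ({a, b, c, d} \<union> Q) a b c d"
      using abcd Q(3)[of d] unfolding first_four_def U_def by blast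
    have "{a, b, c, d} \<inter> Q = {}" using abcd(1) unfolding U_def by blast
    then have "card ({a, b, c, d} \<union> Q) = card {a, b, c, d} + card Q"
      using \<open>finite Q\<close> by (intro card_Un_disjoint) auto
    also have "\<dots> = Suc q" using abcd Q(2) \<open>q \<ge> 3\<close> by simp
    finally show "{a, b, c, d} \<union> Q \<in> [S]\<^bsup>Suc q\<^esup>"
      using abcd(1) \<open>U \<subseteq> S\<close> Q(1) \<open>finite Q\<close> unfolding nsets_def by blast
  qed
  have "\<exists>P R. U = P \<union> R \<and> levels_increasing P \<and> levels_decreasing R"
  proof (cases \<xi>)
    case True
    have free: "\<not> level b c < level c d"
      if "{a, b, c, d} \<subseteq> U" "a < b" "b < c" "c < d" "level b c < level a b" for a b c d
    proof
      assume "level b c < level c d"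
      then have "valley ({a, b, c, d} \<union> Q)"
        using four(1)[OF that(1-4)] that(5) unfolding valley_def by blast
      moreover have "step_up h ({a, b, c, d} \<union> Q)" using four(2)[OF that(1-4)] hom True by blast
      ultimately show False using step_up_valley by blast
    qed
    show ?thesis
      by (rule valley_free_split[OF \<open>finite U\<close> free]) (assumption | blast)+
  next
    case False
    have free: "\<not> level c d < level b c"
      if "{a, b, c, d} \<subseteq> U" "a < b" "b < c" "c < d" "level a b < level b c" for a b c d
    proof
      assume "level c d < level b c"
      then have "peak ({a, b, c, d} \<union> Q)"
        using four(1)[OF that(1-4)] that(5) unfolding peak_def by blast
      then have "step_up h ({a, b, c, d} \<union> Q)" unfolding step_up_def by blast
      then show False using four(2)[OF that(1-4)] hom False by blast
    qed
    show ?thesis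
      by (rule peak_free_split[OF \<open>finite U\<close> cardU(2) free]) (assumption | blast)+
  qed
  then obtain P R where PR: "U = P \<union> R" "levels_increasing P" "levels_decreasing R"
    by blast
  have sub: "step_up h e = \<xi>" if "e \<in> [P]\<^bsup>Suc q\<^esup> \<or> e \<in> [R]\<^bsup>Suc q\<^esup>" for e
    using that hom PR(1) \<open>U \<subseteq> S\<close> nsets_mono[of P S "Suc q"] nsets_mono[of R S "Suc q"] by blast
  have "card P \<le> L"
    by (rule card_increasing_le[OF h _ _ PR(2)]) (use PR(1) \<open>U \<subseteq> S\<close> S sub in auto)
  moreover have "card R \<le> L"
    by (rule card_decreasing_le[OF h _ _ PR(3)]) (use PR(1) \<open>U \<subseteq> S\<close> S sub in auto)
  ultimately have "card U \<le> 2 * L" using PR(1) card_Un_le[of P R] by simp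
  then show False using cardU(1) by simp
qed

section \<open>A hypergraph without twins\<close>

text \<open>With \<open>k + 2\<close> vertices the complement of a path edge has \<open>k\<close>
  elements, so a \<open>k\<close>-set is an edge exactly when its two missing vertices are adjacent
  on the path.\<close>

definition co_path :: "nat \<Rightarrow> nat hypergraph" where
  "co_path k = Hypergraph {..<k + 2} {{..<k + 2} - {i, Suc i} | i. i \<le> k}"

lemma uniform_co_path: "uniform_hypergraph k (co_path k)"
proof -
  have "{..<k + 2} - {i, Suc i} \<in> [{..<k + 2}]\<^bsup>k\<^esup>" if "i \<le> k" for i
    using that by (auto simp: nsets_def card_Diff_subset)
  then show ?thesis by (auto simp: uniform_hypergraph_def co_path_def)
qed

lemma co_path_edge_iff:
  assumes "u < k + 2" "v < k + 2"
  shows "{..<k + 2} - {u, v} \<in> edges (co_path k) \<longleftrightarrow> v = Suc u \<or> u = Suc v"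
proof
  assume "{..<k + 2} - {u, v} \<in> edges (co_path k)"
  then obtain i where i: "i \<le> k" "{..<k + 2} - {u, v} = {..<k + 2} - {i, Suc i}"
    by (auto simp: co_path_def)
  moreover have "{u, v} \<subseteq> {..<k + 2}" "{i, Suc i} \<subseteq> {..<k + 2}" using assms i(1) by auto
  ultimately have "{u, v} = {i, Suc i}" by (metis double_diff order_refl)
  then show "v = Suc u \<or> u = Suc v" by (auto simp: doubleton_eq_iff)
next
  assume "v = Suc u \<or> u = Suc v"
  then obtain i where "{u, v} = {i, Suc i}" "i \<le> k" using assms by fastforce
  then show "{..<k + 2} - {u, v} \<in> edges (co_path k)" unfolding co_path_def by auto
qed

text \<open>No two path vertices have the same neighbours outside themselves: some \<open>w\<close>
  is adjacent to exactly one of \<open>u\<close> and \<open>v\<close>. With \<open>S\<close> the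
  complement of \<open>{u, v, w}\<close>, adding \<open>u\<close> leaves out \<open>v\<close> and
  \<open>w\<close>, and adding \<open>v\<close> leaves out \<open>u\<close> and
  \<open>w\<close>.\<close>

lemma co_path_separates:
  assumes "k \<ge> 2" "u < k + 2" "v < k + 2" "u \<noteq> v"
  obtains S where "S \<subseteq> {..<k + 2} - {u, v}"
    "insert u S \<in> [{..<k + 2}]\<^bsup>k\<^esup>" "insert v S \<in> [{..<k + 2}]\<^bsup>k\<^esup>"
    "(insert u S \<in> edges (co_path k)) \<noteq> (insert v S \<in> edges (co_path k))"
proof -
  have *: "\<exists>w < k + 2. w \<noteq> u \<and> w \<noteq> v \<and>
      (w = Suc u \<or> u = Suc w) \<noteq> (w = Suc v \<or> v = Suc w)"
    if uv: "u < v" "v < k + 2" for u v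
  \<comment> \<open>For \<open>u < v\<close>, the predecessor of \<open>u\<close> works unless
    \<open>u = 0\<close>, and then the successor of \<open>v\<close> works unless \<open>v\<close>
    is the other end of the path. For the two ends, vertex 1 works because
    \<open>k \<ge> 2\<close>.\<close>
  proof (cases "u = 0")
    case False
    then show ?thesis using uv by (intro exI[of _ "u - 1"]) auto
  next
    case u: True
    show ?thesis
    proof (cases "v = k + 1")
      case False
      then show ?thesis using uv by (intro exI[of _ "Suc v"]) auto
    next
      case True
      then show ?thesis using u \<open>k \<ge> 2\<close> by (intro exI[of _ 1]) auto
    qed
  qed
  obtain w where w: "w < k + 2" "w \<noteq> u" "w \<noteq> v"
    "(w = Suc u \<or> u = Suc w) \<noteq> (w = Suc v \<or> v = Suc w)"
    using *[of u v] *[of v u] assms(2-4) by (metis linorder_neqE_nat)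
  define S where "S = {..<k + 2} - {u, v, w}"
  have ins: "insert u S = {..<k + 2} - {v, w}" "insert v S = {..<k + 2} - {u, w}"
    using assms w(1-3) unfolding S_def by auto
  have "{..<k + 2} - {v, w} \<in> [{..<k + 2}]\<^bsup>k\<^esup>" "{..<k + 2} - {u, w} \<in> [{..<k + 2}]\<^bsup>k\<^esup>"
    using assms w(1-3) by (auto simp: nsets_def card_Diff_subset)
  then show ?thesis
    using that[of S] w assms co_path_edge_iff[of v k w] co_path_edge_iff[of u k w]
    by (simp add: ins) (auto simp: S_def)
qed

definition step_up_hypergraph :: "nat \<Rightarrow> nat \<Rightarrow> (nat set \<Rightarrow> bool) \<Rightarrow> nat hypergraph" where
  "step_up_hypergraph k n h = Hypergraph {..<n} {e \<in> [{..<n}]\<^bsup>k\<^esup>. step_up h e}"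

lemma uniform_step_up_hypergraph: "uniform_hypergraph k (step_up_hypergraph k n h)"
  by (auto simp: uniform_hypergraph_def step_up_hypergraph_def)

text \<open>The vertices of an induced copy would contain twins \<open>f u\<close> and
  \<open>f v\<close>. Exchanging them never changes the colour, whereas some set \<open>S\<close>
  separates \<open>u\<close> from \<open>v\<close> in the path hypergraph.\<close>

lemma step_up_hypergraph_free:
  assumes "k \<ge> 2"
  shows "hypergraph_free k (co_path k) (step_up_hypergraph k n h)"
  unfolding hypergraph_free_def
proof
  assume "\<exists>f. induced_copy k f (co_path k) (step_up_hypergraph k n h)"
  then obtain f where f: "f ` {..<k + 2} \<subseteq> {..<n}" "inj_on f {..<k + 2}"
    "\<And>e. e \<in> [{..<k + 2}]\<^bsup>k\<^esup> \<Longrightarrow> e \<in> edges (co_path k) \<longleftrightarrow> f ` e \<in> edges (step_up_hypergraph k n h)"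
    unfolding induced_copy_def by (auto simp: co_path_def step_up_hypergraph_def)
  define X where "X = f ` {..<k + 2}"
  have "finite X" "card X = k + 2" using f(2) by (auto simp: X_def card_image)
  then obtain x y where xy: "x \<in> X" "y \<in> X" "x < y" "twins X x y"
    using ex_twins[of X] by auto
  then obtain u v where uv: "u < k + 2" "v < k + 2" "f u = x" "f v = y" by (auto simp: X_def)
  with xy have "u \<noteq> v" by auto
  from co_path_separates[OF assms uv(1,2) this] obtain S where
    S: "S \<subseteq> {..<k + 2} - {u, v}"
    "insert u S \<in> [{..<k + 2}]\<^bsup>k\<^esup>" "insert v S \<in> [{..<k + 2}]\<^bsup>k\<^esup>"
    "(insert u S \<in> edges (co_path k)) \<noteq> (insert v S \<in> edges (co_path k))"
    by blast
  have edge: "e \<in> edges (co_path k) \<longleftrightarrow> step_up h (f ` e)" if e: "e \<in> [{..<k + 2}]\<^bsup>k\<^esup>" for e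
  proof -
    have "e \<subseteq> {..<k + 2}" "finite e" "card e = k" using e by (auto simp: nsets_def)
    moreover from this have "card (f ` e) = k" using f(2) card_image inj_on_subset by blast
    ultimately have "f ` e \<in> [{..<n}]\<^bsup>k\<^esup>" using f(1) unfolding nsets_def by blast
    then show ?thesis using f(3)[OF e] by (simp add: step_up_hypergraph_def)
  qed
  have "f ` S \<subseteq> X - {x, y}"
  proof
    fix z assume "z \<in> f ` S"
    then obtain s where "s \<in> S" "z = f s" by blast
    then show "z \<in> X - {x, y}"
      using S(1) uv f(2) by (auto simp: X_def dest: inj_onD)
  qed
  from step_up_twins[OF xy(4) this, of h] show False
    using S(4) edge[OF S(2)] edge[OF S(3)] uv(3,4) by simp
qed

lemma homogeneous_number_step_up_le:
  assumes "homogeneous_below (step_up h) k {..<n} B" "k > 0"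
  shows "homogeneous_number k (step_up_hypergraph k n h) \<le> B"
  unfolding homogeneous_number_le_iff[OF uniform_step_up_hypergraph \<open>k > 0\<close>]
proof (intro allI impI)
  fix S assume S: "clique_in k (step_up_hypergraph k n h) S \<or> independent_in k (step_up_hypergraph k n h) S"
  then have sub: "S \<subseteq> {..<n}"
    by (auto simp: clique_in_def independent_in_def step_up_hypergraph_def)
  then have "[S]\<^bsup>k\<^esup> \<subseteq> [{..<n}]\<^bsup>k\<^esup>" by (rule nsets_mono)
  with S have "\<exists>\<xi>. \<forall>e\<in>[S]\<^bsup>k\<^esup>. step_up h e = \<xi>"
    unfolding clique_in_def independent_in_def step_up_hypergraph_def by auto
  then have "card S < B" using homogeneous_belowD[OF assms(1) sub] by blast
  then show "card S \<le> B" by simp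
qed

section \<open>Choice of parameters\<close>

lemma homogeneous_below_subset:
  "homogeneous_below f q V L \<Longrightarrow> W \<subseteq> V \<Longrightarrow> homogeneous_below f q W L"
  unfolding homogeneous_below_def by (meson order_trans)

text \<open>A single point is vacuously homogeneous. Positivity lets additive constants be absorbed
  into a multiple of \<open>ramsey_inverse k n\<close>.\<close>

lemma ramsey_inverse_pos: "n \<ge> 1 \<Longrightarrow> k \<ge> 2 \<Longrightarrow> ramsey_inverse k n \<ge> 1"
proof (rule le_ramsey_inverse)
  assume "n \<ge> 1" "k \<ge> 2"
  have "{0::nat} \<in> [{..<1}]\<^bsup>1\<^esup>" "[{0::nat}]\<^bsup>k\<^esup> = {}"
    using \<open>k \<ge> 2\<close> by (simp_all add: nsets_one nsets_singleton_iff)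
  then have "monochromatic {..<1::nat} 1 k f \<xi>" for f :: "nat set \<Rightarrow> bool" and \<xi>
    unfolding monochromatic_def by (intro bexI[of _ "{0}"]) simp_all
  then have "partn {..<1::nat} 1 k (UNIV :: bool set)" unfolding partn_def by blast
  then have "ramsey_number k 1 \<le> 1" unfolding ramsey_number_def by (rule Least_le)
  with \<open>n \<ge> 1\<close> show "ramsey_number k 1 \<le> n" by simp
qed

text \<open>By maximality of the inverse, the Ramsey number of its successor exceeds
  \<open>n\<close>.\<close>

lemma exists_optimal_colouring:
  assumes "k > 0"
  obtains f :: "nat set \<Rightarrow> bool" where "homogeneous_below f k {..<n} (Suc (ramsey_inverse k n))"
proof -
  have "n < ramsey_number k (Suc (ramsey_inverse k n))"
    using le_ramsey_inverse[of k "Suc (ramsey_inverse k n)" n] by (meson not_le not_less_eq_eq order_refl)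
  then have "\<not> partn {..<n} (Suc (ramsey_inverse k n)) k (UNIV :: bool set)"
    unfolding ramsey_number_def by (rule not_less_Least)
  then show ?thesis using homogeneous_below_if_not_partn that by blast
qed

text \<open>This shows that \<open>q + 1\<close> squarings suffice: the left side bounds the binary
  logarithm of \<open>n\<close> when \<open>M\<close> is the largest size that stepping down
  reaches. The estimates are \<open>Suc M \<le> M ^ 2\<close> and
  \<open>2 * q + 3 \<le> 2 ^ Suc q\<close>.\<close>

lemma exponent_bound:
  fixes M q :: nat
  assumes "M \<ge> 2" "q \<ge> 3"
  shows "Suc M * (Suc M ^ q + 1) \<le> M ^ 2 ^ Suc q"
proof -
  have "Suc M ^ q + 1 \<le> 2 * Suc M ^ q" using one_le_power[of "Suc M" q] by simp
  then have "Suc M * (Suc M ^ q + 1) \<le> Suc M * (2 * Suc M ^ q)" by (rule mult_le_mono2)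
  also have "\<dots> = 2 * Suc M ^ Suc q" by simp
  finally have "Suc M * (Suc M ^ q + 1) \<le> 2 * Suc M ^ Suc q" .
  also have "\<dots> \<le> M * (M ^ 2) ^ Suc q"
  proof (intro mult_mono power_mono)
    have "Suc M \<le> M * 2" using assms(1) by simp
    also have "\<dots> \<le> M ^ 2" using assms(1) by (simp add: power2_eq_square)
    finally show "Suc M \<le> M ^ 2" .
  qed (use assms in auto)
  also have "\<dots> = M ^ (2 * q + 3)" 
    by (simp only: power_mult[symmetric] power_Suc[symmetric]) (simp add: numeral_3_eq_3)
  also have "\<dots> \<le> M ^ 2 ^ Suc q"
  proof (rule power_increasing)
    show "2 * q + 3 \<le> 2 ^ Suc q" using assms(2) by (induction q rule: dec_induct) auto
  qed (use assms(1) in simp)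
  finally show ?thesis .
qed

lemma exists_step_up_colouring:
  assumes q: "q \<ge> 3" and n: "2 ^ (2 * (2 ^ q + 1)) \<le> n"
  obtains h :: "nat set \<Rightarrow> bool" where
    "homogeneous_below (step_up h) (Suc q) {..<n}
       (2 * (q ^ Suc q * Suc (ramsey_inverse (Suc q) n)) + Suc q)"
proof -
  define L where "L = Suc (ramsey_inverse (Suc q) n)"
  define P where "P M \<longleftrightarrow> 2 ^ (M * (M ^ q + 1)) \<le> n" for M
  \<comment> \<open>The largest number of points to which the optimal colouring can be stepped down.
    The lower bound on \<open>n\<close> says precisely that 2 qualifies.\<close>
  define M where "M = (GREATEST M. P M)"
  have bound: "m \<le> n" if "P m" for m
  proof -
    have "m \<le> m * (m ^ q + 1)" by simp
    also have "\<dots> < 2 ^ (m * (m ^ q + 1))" by (rule less_exp)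
    also have "\<dots> \<le> n" using that by (simp add: P_def)
    finally show ?thesis by simp
  qed
  have "P 2" using n by (simp add: P_def)
  then have "P M" "2 \<le> M"
    unfolding M_def using bound by (blast intro: GreatestI_nat Greatest_le_nat)+
  have "\<not> P (Suc M)"
    using Greatest_le_nat[of P "Suc M" n] bound unfolding M_def by fastforce
  then have "n < 2 ^ (Suc M * (Suc M ^ q + 1))" by (simp add: P_def)
  also have "\<dots> \<le> 2 ^ (M ^ 2 ^ Suc q)"
    using exponent_bound[OF \<open>2 \<le> M\<close> q] by (intro power_increasing) auto
  finally have small: "{..<n} \<subseteq> {..<2 ^ (M ^ 2 ^ Suc q)}" by auto
  obtain f :: "nat set \<Rightarrow> bool" where "homogeneous_below f (Suc q) {..<n} L"
    using exists_optimal_colouring[of "Suc q" n] unfolding L_def by blast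
  then obtain g :: "nat set \<Rightarrow> bool" where "homogeneous_below g q {..<M} L"
    using homogeneous_below_step_down[of f q n L M] q \<open>P M\<close> unfolding P_def by auto
  then obtain h where "homogeneous_below h q {..<M ^ 2 ^ Suc q} (q ^ Suc q * L)"
    using homogeneous_below_power q by blast
  \<comment> \<open>Stepping up may produce more than \<open>n\<close> vertices; the colouring is
    restricted to the first \<open>n\<close>.\<close>
  from homogeneous_below_subset[OF homogeneous_below_step_up[OF this q] small] show ?thesis
    using that unfolding L_def by blast
qed

theorem theorem1p2:
  fixes k :: nat
  assumes "k \<ge> 4"
  shows "\<exists>(c :: real) (H :: nat hypergraph) (G :: nat \<Rightarrow> nat hypergraph).
    uniform_hypergraph k H \<and>
    (\<forall>n. uniform_hypergraph k (G n) \<and>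
         card (verts (G n)) = n \<and>
         hypergraph_free k H (G n) \<and>
         real (homogeneous_number k (G n)) \<le> c * real (ramsey_inverse k n))"
proof -
  obtain q where k: "k = Suc q" and q: "q \<ge> 3" using assms by (cases k) auto
  define n0 :: nat where "n0 = 2 ^ (2 * (2 ^ q + 1))"
  \<comment> \<open>The summand \<open>n0\<close> covers small \<open>n\<close> by the trivial bound
    \<open>n\<close>. The rest comes from \<open>2 * (q ^ k * Suc l) + k\<close> with
    \<open>Suc l \<le> 2 * l\<close> and \<open>k \<le> k * l\<close>.\<close>
  define c where "c = n0 + 4 * q ^ k + k"
  have "\<exists>h. homogeneous_number k (step_up_hypergraph k n h) \<le> c * ramsey_inverse k n" for n
  proof (cases "n = 0 \<or> n < n0")
    case True
    have "homogeneous_number k (step_up_hypergraph k n h) \<le> n" for h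
    proof (subst homogeneous_number_le_iff[OF uniform_step_up_hypergraph])
      show "\<forall>S. clique_in k (step_up_hypergraph k n h) S \<or>
          independent_in k (step_up_hypergraph k n h) S \<longrightarrow> card S \<le> n"
        using card_mono[of "{..<n}"]
        by (auto simp: clique_in_def independent_in_def step_up_hypergraph_def)
    qed (use assms in simp)
    moreover have "n \<le> c * ramsey_inverse k n"
    \<comment> \<open>The lower bound 1 on \<open>ramsey_inverse k n\<close> is available only for
      positive \<open>n\<close>.\<close>
    proof (cases "n = 0")
      case False
      then have "n \<le> c * 1" using True by (simp add: c_def)
      also have "\<dots> \<le> c * ramsey_inverse k n"
        using ramsey_inverse_pos[of n k] False assms by (intro mult_le_mono2) auto
      finally show ?thesis .
    qed simp
    ultimately show ?thesis using order_trans by blast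
  next
    case False
    define l where "l = ramsey_inverse k n"
    have "l \<ge> 1" using ramsey_inverse_pos[of n k] False assms by (simp add: l_def)
    from False have "2 ^ (2 * (2 ^ q + 1)) \<le> n" by (simp add: n0_def)
    from exists_step_up_colouring[OF q this] obtain h where
      "homogeneous_below (step_up h) k {..<n} (2 * (q ^ k * Suc l) + k)"
      unfolding k l_def by blast
    then have "homogeneous_number k (step_up_hypergraph k n h) \<le> 2 * (q ^ k * Suc l) + k"
      by (rule homogeneous_number_step_up_le) (simp add: k)
    also have "\<dots> \<le> 2 * (q ^ k * (2 * l)) + k * l"
      using \<open>l \<ge> 1\<close> by (intro add_mono mult_le_mono2) auto
    also have "\<dots> \<le> c * l" by (simp add: c_def algebra_simps)
    finally show ?thesis unfolding l_def by blast
  qed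
  then obtain h where
    h: "\<And>n. homogeneous_number k (step_up_hypergraph k n (h n)) \<le> c * ramsey_inverse k n"
    by metis
  show ?thesis
  proof (intro exI conjI allI)
    show "uniform_hypergraph k (co_path k)" by (rule uniform_co_path)
    fix n
    show "uniform_hypergraph k (step_up_hypergraph k n (h n))"
      by (rule uniform_step_up_hypergraph)
    show "card (verts (step_up_hypergraph k n (h n))) = n"
      by (simp add: step_up_hypergraph_def)
    show "hypergraph_free k (co_path k) (step_up_hypergraph k n (h n))"
      using assms by (intro step_up_hypergraph_free) simp
    show "real (homogeneous_number k (step_up_hypergraph k n (h n)))
        \<le> real c * real (ramsey_inverse k n)"
      using h[of n] by (simp flip: of_nat_mult)
  qed
qed

end
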